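(* For all integers $n,r\ge 0$ and $\lambda\ge 1$, $$\tilde B_r^\lambda(1;n)=\sum_{k=0}^{n}\ \sum_{i_1=k}^{n}\binom{n}{i_1}\sum_{i_2=k}^{i_1}\binom{i_1}{i_2}\sum_{i_3=k}^{i_2}\binom{i_2}{i_3}\cdots\sum_{i_r=k}^{i_{r-1}}\binom{i_{r-1}}{i_r}\,\mathcal{W}_{2,0}(i_r,k)\,\lambda^k,$$ where there are $r$ nested inner sums over $i_1,\dots,i_r$ and $i_0:=n$ (so for $r=0$ the right-hand side is $\sum_{k=0}^n\mathcal{W}_{2,0}(n,k)\lambda^k$).
   Context: For integers $m\ge 1$ and $r,n,k\ge 0$, the $r$-Whitney numbers of the second kind are $$\mathcal{W}_{m,r}(n,k)=\frac{1}{m^k k!}\sum_{t=0}^{k}(-1)^t\binom{k}{t}\,[m(k-t)+r]^n,$$ with the convention $0^0=1$. For integers $n,r\ge 0$, $\lambda\ge 1$, $\tilde B_r^\lambda(1;n)$ denotes the number of configurations on $[n+r]=\{1,\dots,n+r\}$ of the following kind: the first $r$ elements form $r$ singleton blocks (the distinguishable blocks); the elements $r+1,\dots,n+r$ are partitioned into $k$ non-empty subsets, where $k$ runs over $0,\dots,n$ (all $k$ are counted); each of these $k$ subsets either is placed into one of $\lambda$ labelled sections or is paired up with one of the $r$ singletons, each singleton being paired with at most one subset; and, among the subsets placed in the same section, each subset is either paired with exactly one other subset of that section or is not paired at all (i.e. a matching on the subsets in each section). Subsets within a section are unordered. *)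

theory Defs
  imports Complex_Main "HOL-Library.Disjoint_Sets" "HOL-Library.FuncSet"
begin

text \<open>
  The \<open>r\<close>-Whitney numbers of the second kind. Since \<open>t \<le> k\<close> throughout the sum, the
  truncated subtraction \<open>k - t\<close> is exact.
\<close>

definition whitney2 :: "nat \<Rightarrow> nat \<Rightarrow> nat \<Rightarrow> nat \<Rightarrow> real" where
  "whitney2 m r n k =
     1 / (real m ^ k * fact k) *
     (\<Sum>t=0..k. (-1) ^ t * real (k choose t) * real (m * (k - t) + r) ^ n)"

text \<open>
  A subset is either placed into a section (identified by its label) or paired up with a
  singleton block.
\<close>

datatype placement = In_Section nat | With_Singleton "nat set"

definition singleton_blocks :: "nat \<Rightarrow> nat set set" where
  "singleton_blocks r = (\<lambda>j. {j}) ` {1..r}"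

text \<open>
  A configuration is a triple \<open>(P, a, M)\<close>: the partition \<open>P\<close> of the last \<open>n\<close> elements of
  \<open>{1..n + r}\<close>, the placement \<open>a\<close> of its members, and the set \<open>M\<close> of matched pairs.
  The number of members of \<open>P\<close> is not fixed, so all \<open>k = 0, \<dots>, n\<close> are covered. The function
  \<open>a\<close> is extensional, so that it is determined by its values on \<open>P\<close>. Members
  of \<open>P\<close> lying in no element of \<open>M\<close> are the unmatched ones.
\<close>

definition is_placement :: "nat \<Rightarrow> nat \<Rightarrow> nat set set \<Rightarrow> (nat set \<Rightarrow> placement) \<Rightarrow> bool" where
  "is_placement r l P a \<longleftrightarrow>
     a \<in> P \<rightarrow>\<^sub>E (In_Section ` {1..l} \<union> With_Singleton ` singleton_blocks r) \<and>
     (\<forall>S \<in> singleton_blocks r. \<forall>B \<in> P. \<forall>C \<in> P.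
        a B = With_Singleton S \<longrightarrow> a C = With_Singleton S \<longrightarrow> B = C)"

definition is_section_matching :: "nat \<Rightarrow> nat set set \<Rightarrow> (nat set \<Rightarrow> placement) \<Rightarrow> nat set set set \<Rightarrow> bool" where
  "is_section_matching l P a M \<longleftrightarrow>
     (\<forall>e \<in> M. \<exists>s \<in> {1..l}. \<exists>B \<in> P. \<exists>C \<in> P.
        e = {B, C} \<and> B \<noteq> C \<and> a B = In_Section s \<and> a C = In_Section s) \<and>
     disjoint M"

definition configurations ::
  "nat \<Rightarrow> nat \<Rightarrow> nat \<Rightarrow> (nat set set \<times> (nat set \<Rightarrow> placement) \<times> nat set set set) set" where
  "configurations r l n =
     {(P, a, M). partition_on {r + 1..n + r} P \<and> is_placement r l P a \<and> is_section_matching l P a M}"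

definition B_tilde :: "nat \<Rightarrow> nat \<Rightarrow> nat \<Rightarrow> nat" where
  "B_tilde r l n = card (configurations r l n)"

text \<open>
  \<open>nested_sum k f r n\<close> is the \<open>r\<close>-fold sum over \<open>i\<^sub>1, \<dots>, i\<^sub>r\<close>, where \<open>i\<^sub>j\<close> ranges over
  \<open>{k..i\<^sub>j\<^sub>-\<^sub>1}\<close> with weight \<open>i\<^sub>j\<^sub>-\<^sub>1 choose i\<^sub>j\<close> and \<open>i\<^sub>0 = n\<close>, of the innermost term \<open>f i\<^sub>r\<close>.
\<close>

primrec nested_sum :: "nat \<Rightarrow> (nat \<Rightarrow> real) \<Rightarrow> nat \<Rightarrow> nat \<Rightarrow> real" where
  "nested_sum k f 0 n = f n"
| "nested_sum k f (Suc r) n = (\<Sum>i=k..n. real (n choose i) * nested_sum k f r i)"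

end

theory Submission
  imports Defs
begin

text \<open>
  Both sides satisfy the same two recurrences.

  Forgetting one distinguishable singleton is a binomial convolution with the constant \<open>1\<close>: a
  configuration with \<open>r + 1\<close> singletons is determined by the subset paired with the extra
  singleton, where the empty set encodes that there is none, and a configuration with \<open>r\<close>
  singletons on the remaining \<open>i\<close> elements. Hence
  \[ \tilde B_{r+1}(n) = \sum_i \binom{n}{i} \tilde B_r(i), \]
  which is the recursion defining the nested sum (\<open>bij_betw_remove_singleton\<close>,
  \<open>sum_nested_sum_Suc\<close>).

  This leaves the case without singletons. A configuration on \<open>n + 1\<close> elements consists of the
  component of one chosen element \<open>x\<close>, namely the block of \<open>x\<close> together with its partner if it is
  matched, and a configuration on the remaining \<open>j\<close> elements. The component lies in one of
  \<open>\<lambda>\<close> sections, and its \<open>n - j\<close> elements other than \<open>x\<close> are split freely between the block of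
  \<open>x\<close> and the partner, the empty partner encoding an unmatched block. Hence
  \[ b(n+1) = \sum_j \binom{n}{j} \lambda 2^{n-j} b(j) \]
  (\<open>bij_betw_remove_component\<close>). The polynomials \<open>\<Sum>\<^sub>k W(n,k) \<lambda>\<^sup>k\<close> for \<open>m = 2\<close>, \<open>r = 0\<close> satisfy
  the same recurrence (\<open>whitney_poly_Suc\<close>), by absorption and the binomial theorem applied to the
  explicit formula.

  The recursions delete arbitrary sets of elements and singletons, so configurations are counted
  over an arbitrary finite ground set and an arbitrary finite set of singletons.
\<close>

section \<open>Whitney numbers and nested sums\<close>

lemma sum_Pow_card:
  fixes g :: "nat \<Rightarrow> real"
  assumes "finite A"
  shows "(\<Sum>U\<in>Pow A. g (card U)) = (\<Sum>i=0..card A. real (card A choose i) * g i)"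
proof -
  have "(\<Sum>U\<in>Pow A. g (card U)) = (\<Sum>i\<in>{0..card A}. \<Sum>U\<in>{U\<in>Pow A. card U = i}. g (card U))"
    using assms by (intro sum.group [symmetric]) (auto intro: card_mono)
  also have "\<dots> = (\<Sum>i=0..card A. real (card A choose i) * g i)"
    using n_subsets [OF assms] by (intro sum.cong) auto
  finally show ?thesis .
qed

lemma whitney2_0_Suc: "whitney2 m r 0 (Suc k) = 0"
  using choose_alternating_sum[of "Suc k", where ?'a = real]
  by (simp add: whitney2_def atLeast0AtMost)

lemma whitney2_Suc_0: "whitney2 m 0 (Suc n) 0 = 0"
  by (simp add: whitney2_def)

text \<open>
  The exponential generating function of \<open>whitney2 m 0 n k\<close> in \<open>n\<close> is
  \<open>(e\<^sup>m\<^sup>x - 1)\<^sup>k / (m\<^sup>k k!)\<close>, and the identity is what differentiating it gives. On the level of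
  the explicit formula, one power of \<open>m (k + 1 - t)\<close> is absorbed into the binomial coefficient,
  and the others are expanded as powers of \<open>m (k - t) + m\<close>.
\<close>

lemma whitney2_Suc_Suc:
  assumes "m \<ge> 1"
  shows "whitney2 m 0 (Suc n) (Suc k) =
    (\<Sum>j=0..n. real (n choose j) * real m ^ (n - j) * whitney2 m 0 j k)"
proof -
  let ?c = "1 / (real m ^ k * fact k)"
  have shift: "(\<Sum>j=0..n. real (n choose j) * real m ^ (n - j) * real (m * (k - t)) ^ j)
      = real (m * (Suc k - t)) ^ n" if "t \<le> k" for t
  proof -
    have "real (m * (Suc k - t)) = real (m * (k - t)) + real m"
      using that by (auto simp: le_iff_add algebra_simps)
    then show ?thesis
      by (simp add: binomial_ring atLeast0AtMost mult.commute mult.left_commute)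
  qed
  have absorb: "real (Suc k choose t) * real (m * (Suc k - t)) ^ Suc n
      = real m * real (Suc k) * (real (k choose t) * real (m * (Suc k - t)) ^ n)" for t
  proof -
    have "real (Suc k choose t) * real (Suc k - t) = real (Suc k) * real (k choose t)"
      using binomial_absorb_comp[of "Suc k" t]
      by (metis diff_Suc_1 mult.commute of_nat_mult)
    then have "real (Suc k choose t) * real (Suc k - t) * (real m * real (m * (Suc k - t)) ^ n)
      = real (Suc k) * real (k choose t) * (real m * real (m * (Suc k - t)) ^ n)" by simp
    then show ?thesis by (simp add: mult_ac)
  qed
  have "(\<Sum>j=0..n. real (n choose j) * real m ^ (n - j) * whitney2 m 0 j k)
      = (\<Sum>j=0..n. \<Sum>t=0..k. ?c * ((-1) ^ t * real (k choose t)) *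
          (real (n choose j) * real m ^ (n - j) * real (m * (k - t)) ^ j))"
    by (simp add: whitney2_def sum_distrib_left mult_ac)
  also have "\<dots> = (\<Sum>t=0..k. ?c * ((-1) ^ t * real (k choose t)) *
          (\<Sum>j=0..n. real (n choose j) * real m ^ (n - j) * real (m * (k - t)) ^ j))"
    by (subst sum.swap) (simp only: sum_distrib_left)
  also have "\<dots> = (\<Sum>t=0..k. ?c * ((-1) ^ t * (real (k choose t) * real (m * (Suc k - t)) ^ n)))"
    by (intro sum.cong refl, subst shift) (auto simp: mult_ac)
  also have "\<dots> = (\<Sum>t=0..k. 1 / (real m ^ Suc k * fact (Suc k)) *
      ((-1) ^ t * (real m * real (Suc k) * (real (k choose t) * real (m * (Suc k - t)) ^ n))))"
  proof (intro sum.cong refl)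
    fix t
    have "?c = 1 / (real m ^ Suc k * fact (Suc k)) * (real m * real (Suc k))"
      using assms by (simp add: divide_simps del: of_nat_Suc)
    then show "?c * ((-1) ^ t * (real (k choose t) * real (m * (Suc k - t)) ^ n)) =
      1 / (real m ^ Suc k * fact (Suc k)) *
      ((-1) ^ t * (real m * real (Suc k) * (real (k choose t) * real (m * (Suc k - t)) ^ n)))"
      by (simp only: mult_ac)
  qed
  also have "\<dots> = (\<Sum>t=0..k. 1 / (real m ^ Suc k * fact (Suc k)) *
      ((-1) ^ t * (real (Suc k choose t) * real (m * (Suc k - t)) ^ Suc n)))"
    by (simp only: absorb)
  also have "\<dots> = whitney2 m 0 (Suc n) (Suc k)"
    by (simp add: whitney2_def sum_distrib_left mult_ac del: binomial_Suc_Suc fact_Suc)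
  finally show ?thesis by simp
qed

lemma whitney2_eq_0:
  assumes "m \<ge> 1" "n < k"
  shows "whitney2 m 0 n k = 0"
  using assms(2)
proof (induction n arbitrary: k rule: less_induct)
  case (less n)
  then obtain k' where k: "k = Suc k'" by (cases k) auto
  show ?case
  proof (cases n)
    case 0
    then show ?thesis by (simp add: k whitney2_0_Suc)
  next
    case (Suc n')
    have "whitney2 m 0 j k' = 0" if "j \<le> n'" for j
      using less that Suc k by auto
    then show ?thesis by (simp add: k Suc whitney2_Suc_Suc[OF assms(1)])
  qed
qed

definition whitney_poly :: "nat \<Rightarrow> real \<Rightarrow> nat \<Rightarrow> real" where
  "whitney_poly m x n = (\<Sum>k=0..n. whitney2 m 0 n k * x ^ k)"

text \<open>
  Since \<open>whitney2 m 0 j k\<close> vanishes for \<open>k > j\<close>, each polynomial with \<open>j \<le> n\<close> may be summed up to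
  the common bound \<open>n\<close>, after which the two sums can be interchanged.
\<close>

lemma whitney_poly_Suc:
  assumes "m \<ge> 1"
  shows "whitney_poly m x (Suc n) =
    (\<Sum>j=0..n. real (n choose j) * (x * real m ^ (n - j) * whitney_poly m x j))"
proof -
  have ext: "whitney_poly m x j = (\<Sum>k=0..n. whitney2 m 0 j k * x ^ k)" if "j \<le> n" for j
    unfolding whitney_poly_def using that whitney2_eq_0[OF assms]
    by (intro sum.mono_neutral_left) auto
  have "whitney_poly m x (Suc n) = (\<Sum>k=0..n. whitney2 m 0 (Suc n) (Suc k) * x ^ Suc k)"
    unfolding whitney_poly_def
    by (subst sum.atLeast0_atMost_Suc_shift) (simp add: whitney2_Suc_0)
  also have "\<dots> = (\<Sum>k=0..n. \<Sum>j=0..n. real (n choose j) *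
      (x * real m ^ (n - j) * (whitney2 m 0 j k * x ^ k)))"
    by (simp add: whitney2_Suc_Suc[OF assms] sum_distrib_right sum_distrib_left mult_ac)
  also have "\<dots> = (\<Sum>j=0..n. real (n choose j) *
      (x * real m ^ (n - j) * (\<Sum>k=0..n. whitney2 m 0 j k * x ^ k)))"
    by (subst sum.swap) (simp add: sum_distrib_left)
  also have "\<dots> = (\<Sum>j=0..n. real (n choose j) * (x * real m ^ (n - j) * whitney_poly m x j))"
    using ext by (intro sum.cong) auto
  finally show ?thesis .
qed

text \<open>
  In the outermost nested sum \<open>i\<close> starts at \<open>k\<close>. When the sum over \<open>k\<close> is moved inside, this bound
  becomes \<open>k \<le> i\<close>, so the inner sum is the left-hand side with \<open>i\<close> for \<open>n\<close> and \<open>r\<close> for \<open>Suc r\<close>.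
\<close>

lemma sum_nested_sum_Suc:
  "(\<Sum>k=0..n. nested_sum k (f k) (Suc r) n) =
    (\<Sum>i=0..n. real (n choose i) * (\<Sum>k=0..i. nested_sum k (f k) r i))"
proof -
  have "(\<Sum>k=0..n. nested_sum k (f k) (Suc r) n) =
    (\<Sum>k\<in>{0..n}. \<Sum>i\<in>{i\<in>{0..n}. k \<le> i}. real (n choose i) * nested_sum k (f k) r i)"
    by (auto intro!: sum.cong)
  also have "\<dots> = (\<Sum>i\<in>{0..n}. \<Sum>k\<in>{k\<in>{0..n}. k \<le> i}. real (n choose i) * nested_sum k (f k) r i)"
    by (rule sum.swap_restrict) auto
  also have "\<dots> = (\<Sum>i=0..n. real (n choose i) * (\<Sum>k=0..i. nested_sum k (f k) r i))"
    by (auto intro!: sum.cong simp: sum_distrib_left)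
  finally show ?thesis .
qed

section \<open>Configurations over arbitrary ground sets\<close>

definition placement_on ::
  "nat \<Rightarrow> nat set set \<Rightarrow> nat set set \<Rightarrow> (nat set \<Rightarrow> placement) \<Rightarrow> bool" where
  "placement_on l T P a \<longleftrightarrow>
     a \<in> P \<rightarrow>\<^sub>E (In_Section ` {1..l} \<union> With_Singleton ` T) \<and>
     (\<forall>S \<in> T. \<forall>B \<in> P. \<forall>C \<in> P.
        a B = With_Singleton S \<longrightarrow> a C = With_Singleton S \<longrightarrow> B = C)"

definition configurations_on ::
  "nat \<Rightarrow> nat set \<Rightarrow> nat set set \<Rightarrow> (nat set set \<times> (nat set \<Rightarrow> placement) \<times> nat set set set) set"
  where
  "configurations_on l A T =
     {(P, a, M). partition_on A P \<and> placement_on l T P a \<and> is_section_matching l P a M}"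

lemma placement_on_iff:
  "placement_on l T P a \<longleftrightarrow>
     a \<in> extensional P \<and>
     (\<forall>B\<in>P. (\<exists>s\<in>{1..l}. a B = In_Section s) \<or> (\<exists>S\<in>T. a B = With_Singleton S)) \<and>
     (\<forall>S\<in>T. \<forall>B\<in>P. \<forall>C\<in>P. a B = With_Singleton S \<longrightarrow> a C = With_Singleton S \<longrightarrow> B = C)"
  unfolding placement_on_def PiE_def Pi_def by (simp add: image_iff Bex_def) blast

lemma placement_on_insert_singleton_iff:
  assumes "S \<notin> T" "\<forall>B\<in>P. a B \<noteq> With_Singleton S"
  shows "placement_on l (insert S T) P a \<longleftrightarrow> placement_on l T P a"
  using assms by (simp add: placement_on_iff)

lemma placement_on_never:
  assumes "placement_on l T P a" "S \<notin> T" "B \<in> P"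
  shows "a B \<noteq> With_Singleton S"
  using assms by (force simp: placement_on_iff)

lemma placement_on_restrict:
  assumes "placement_on l T P a" "Q \<subseteq> P"
  shows "placement_on l T Q (restrict a Q)"
  using assms by (simp add: placement_on_iff subset_iff)

lemma placement_on_add_singleton:
  assumes "placement_on l T P a" "S \<notin> T" "X \<notin> P"
  shows "placement_on l (insert S T) (insert X P) (a(X := With_Singleton S))"
  using assms placement_on_never[OF assms(1,2)]
  by (auto simp: placement_on_iff extensional_def)

lemma placement_on_add_section:
  assumes "placement_on l T P a" "s \<in> {1..l}" "X \<notin> P"
  shows "placement_on l T (insert X P) (a(X := In_Section s))"
  using assms by (auto simp: placement_on_iff extensional_def)

lemma section_matching_Union:
  assumes "is_section_matching l P a M"
  shows "\<Union>M \<subseteq> P"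
  using assms unfolding is_section_matching_def by fastforce

text \<open>
  Adding or deleting blocks that are not matched does not affect a matching; only the placement of
  the matched blocks matters.
\<close>

lemma section_matching_transfer:
  assumes "is_section_matching l P a M" "N \<subseteq> M" "\<Union>N \<subseteq> Q" "\<forall>B\<in>Q \<inter> P. b B = a B"
  shows "is_section_matching l Q b N"
proof -
  have "\<exists>s \<in> {1..l}. \<exists>B \<in> Q. \<exists>C \<in> Q. e = {B, C} \<and> B \<noteq> C \<and> b B = In_Section s \<and> b C = In_Section s"
    if e: "e \<in> N" for e
  proof -
    obtain s B C where h: "s \<in> {1..l}" "B \<in> P" "C \<in> P" "e = {B, C}" "B \<noteq> C"
        "a B = In_Section s" "a C = In_Section s"
      using assms(1,2) e unfolding is_section_matching_def by (meson subsetD)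
    have Q: "B \<in> Q" "C \<in> Q" using assms(3) e h(4) by auto
    then have "b B = In_Section s" "b C = In_Section s" using assms(4) h by simp_all
    with Q h(1,4,5) show ?thesis by metis
  qed
  moreover have "disjoint N"
    using assms(1,2) unfolding is_section_matching_def by (meson pairwise_subset)
  ultimately show ?thesis by (simp add: is_section_matching_def)
qed

lemma section_matching_insert:
  assumes "is_section_matching l P a M" "s \<in> {1..l}" "B \<in> P" "C \<in> P" "B \<noteq> C"
    "a B = In_Section s" "a C = In_Section s" "B \<notin> \<Union>M" "C \<notin> \<Union>M"
  shows "is_section_matching l P a (insert {B, C} M)"
  unfolding is_section_matching_def
proof
  show "\<forall>e\<in>insert {B, C} M. \<exists>s\<in>{1..l}. \<exists>B\<in>P. \<exists>C\<in>P.
      e = {B, C} \<and> B \<noteq> C \<and> a B = In_Section s \<and> a C = In_Section s"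
    using assms unfolding is_section_matching_def by blast
  show "disjoint (insert {B, C} M)"
    using assms unfolding is_section_matching_def
    by (auto simp: pairwise_insert disjnt_def)
qed

lemma partition_on_add_block:
  assumes "partition_on U P" "X \<noteq> {}" "X \<inter> U = {}"
  shows "partition_on (X \<union> U) (insert X P)"
proof -
  have "disjnt X (\<Union>P)" using assms by (auto simp: partition_on_def disjnt_def)
  moreover have "X \<union> U - X = U" using assms(3) by blast
  ultimately show ?thesis using assms by (simp add: partition_on_insert)
qed

lemma partition_on_remove_block:
  assumes "partition_on A P" "X \<in> P"
  shows "partition_on (A - X) (P - {X})"
proof -
  have "disjnt X (\<Union>(P - {X}))"
    using assms by (auto simp: partition_on_def disjnt_def disjoint_def)
  from partition_on_insert[OF this, of A] show ?thesis
    using assms by (simp add: insert_absorb)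
qed

lemma fun_upd_restrict_same:
  assumes "a \<in> extensional (insert X Q)"
  shows "(restrict a Q)(X := a X) = a"
  using assms by (auto simp: fun_eq_iff extensional_def)

section \<open>Removing a distinguishable singleton\<close>

text \<open>
  The set \<open>U\<close> consists of the elements outside the subset paired with \<open>S\<close>; the case \<open>U = A\<close> encodes
  that \<open>S\<close> is unpaired. The inverse finds the paired subset as the union of all
  blocks placed at \<open>S\<close>: there is at most one of them, and the union is empty if there is none.
\<close>

lemma bij_betw_remove_singleton:
  assumes "S \<notin> T"
  shows "bij_betw
    (\<lambda>(U, P, a, M). if U = A then (P, a, M)
       else (insert (A - U) P, a(A - U := With_Singleton S), M))
    (SIGMA U:Pow A. configurations_on l U T) (configurations_on l A (insert S T))"
    (is "bij_betw ?g ?D ?R")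
proof -
  define f where "f = (\<lambda>(P, a :: nat set \<Rightarrow> placement, M :: nat set set set).
    let X = \<Union>{B \<in> P. a B = With_Singleton S} in (A - X, P - {X}, restrict a (P - {X}), M))"
  have g: "?g z \<in> ?R \<and> f (?g z) = z" if z: "z \<in> ?D" for z
  proof -
    obtain U P a M where zeq: "z = (U, P, a, M)" by (cases z) auto
    from z have h: "U \<subseteq> A" "partition_on U P" "placement_on l T P a" "is_section_matching l P a M"
      by (auto simp: zeq configurations_on_def)
    note nv = placement_on_never[OF h(3) assms]
    have ext: "restrict a P = a"
      using h(3) by (auto simp: placement_on_iff intro: extensional_restrict)
    have ne: "{} \<notin> P" using h(2) by (auto dest: partition_onD3)
    show ?thesis
    proof (cases "U = A")
      case True
      have em: "{B \<in> P. a B = With_Singleton S} = {}" using nv by auto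
      have "f (P, a, M) = (A, P, a, M)"
        unfolding f_def prod.case em Let_def using ne ext by simp
      moreover have "placement_on l (insert S T) P a"
        using nv h(3) placement_on_insert_singleton_iff[OF assms, of P a l] by auto
      ultimately show ?thesis using True h by (simp add: zeq configurations_on_def)
    next
      case False
      define X where "X = A - U"
      have X: "X \<noteq> {}" "X \<inter> U = {}" "A = X \<union> U" using False h(1) by (auto simp: X_def)
      have XP: "X \<notin> P" using X h(2) by (auto simp: partition_on_def)
      have p: "partition_on A (insert X P)"
        unfolding X(3) by (rule partition_on_add_block) (use X h(2) in auto)
      have m: "is_section_matching l (insert X P) (a(X := With_Singleton S)) M"
        by (rule section_matching_transfer[OF h(4)]) (use section_matching_Union[OF h(4)] XP in auto)
      have em: "{B \<in> insert X P. (a(X := With_Singleton S)) B = With_Singleton S} = {X}"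
        using nv by auto
      have r: "restrict (a(X := With_Singleton S)) (insert X P - {X}) = a"
        using XP ext by (metis Diff_insert_absorb restrict_fupd)
      have "?g z = (insert X P, a(X := With_Singleton S), M)"
        using False by (simp add: zeq X_def)
      moreover have "f (insert X P, a(X := With_Singleton S), M) = z"
        unfolding f_def prod.case em Let_def using X XP r by (auto simp: zeq)
      ultimately show ?thesis
        using p m placement_on_add_singleton[OF h(3) assms XP] by (simp add: configurations_on_def)
    qed
  qed
  have f: "f c \<in> ?D \<and> ?g (f c) = c" if c: "c \<in> ?R" for c
  proof -
    obtain P a M where ceq: "c = (P, a, M)" by (cases c) auto
    from c have h: "partition_on A P" "placement_on l (insert S T) P a" "is_section_matching l P a M"
      by (auto simp: ceq configurations_on_def)
    have ae: "a \<in> extensional P" using h(2) by (simp add: placement_on_iff)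
    then have ext: "restrict a P = a" by (rule extensional_restrict)
    have ne: "{} \<notin> P" using h(1) by (auto dest: partition_onD3)
    show ?thesis
    proof (cases "\<exists>X\<in>P. a X = With_Singleton S")
      case False
      then have em: "{B \<in> P. a B = With_Singleton S} = {}" by auto
      have "f c = (A, P, a, M)"
        unfolding f_def ceq prod.case em Let_def using ne ext by simp
      moreover have "placement_on l T P a"
        using False h(2) placement_on_insert_singleton_iff[OF assms, of P a l] by auto
      ultimately show ?thesis using h by (simp add: ceq configurations_on_def)
    next
      case True
      then obtain X where X: "X \<in> P" "a X = With_Singleton S" by auto
      have uniq: "B = X" if "B \<in> P" "a B = With_Singleton S" for B
        using h(2) that X unfolding placement_on_def by blast
      then have em: "{B \<in> P. a B = With_Singleton S} = {X}" using X by blast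
      have XA: "X \<subseteq> A" "X \<noteq> {}" using X h(1) ne by (auto simp: partition_on_def)
      have feq: "f c = (A - X, P - {X}, restrict a (P - {X}), M)"
        unfolding f_def ceq prod.case em Let_def by simp
      have p: "partition_on (A - X) (P - {X})"
        using h(1) X(1) by (rule partition_on_remove_block)
      have XM: "X \<notin> \<Union>M"
        using h(3) X(2) unfolding is_section_matching_def by fastforce
      have m: "is_section_matching l (P - {X}) (restrict a (P - {X})) M"
        by (rule section_matching_transfer[OF h(3)]) (use section_matching_Union[OF h(3)] XM in auto)
      have "placement_on l (insert S T) (P - {X}) (restrict a (P - {X}))"
        using h(2) by (rule placement_on_restrict) auto
      moreover have "\<forall>B\<in>P - {X}. restrict a (P - {X}) B \<noteq> With_Singleton S" using uniq by simp blast
      ultimately have q: "placement_on l T (P - {X}) (restrict a (P - {X}))"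
        using placement_on_insert_singleton_iff[OF assms] by blast
      have "A - (A - X) = X" "A - X \<noteq> A" using XA by auto
      moreover have "(restrict a (P - {X}))(X := With_Singleton S) = a"
        using fun_upd_restrict_same[of a X "P - {X}"] ae X by (simp add: insert_absorb)
      ultimately show ?thesis
        unfolding feq using p m q X by (simp add: ceq configurations_on_def insert_absorb)
    qed
  qed
  show ?thesis
    by (rule bij_betw_byWitness[where f' = f]) (use f g in blast)+
qed

section \<open>Removing the component of an element\<close>

text \<open>
  Here \<open>s\<close> is the section of \<open>x\<close>, \<open>Z\<close> the block matched with the block of \<open>x\<close> (empty if there is
  none), and \<open>U\<close> the set of elements outside the component of \<open>x\<close>; the block of \<open>x\<close> is what
  remains. Without singletons every block lies in a section, so every configuration arises.
  The free choice of \<open>Z\<close> accounts for the factor \<open>2\<close> to the power \<open>card (A - U)\<close>.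
\<close>

lemma bij_betw_remove_component:
  assumes "x \<notin> A"
  shows "bij_betw
    (\<lambda>(s, U, Z, P, a, M). let B = insert x (A - U - Z) in
       if Z = {} then (insert B P, a(B := In_Section s), M)
       else (insert B (insert Z P), a(Z := In_Section s, B := In_Section s), insert {B, Z} M))
    ({1..l} \<times> (SIGMA U:Pow A. Pow (A - U) \<times> configurations_on l U {}))
    (configurations_on l (insert x A) {})"
    (is "bij_betw ?g ?D ?R")
proof -
  \<comment> \<open>At most one edge contains \<open>B\<close>, so the union defining \<open>Z\<close> is the partner of \<open>B\<close> or empty. In the
    latter case, removing \<open>Z\<close> from \<open>P\<close> and \<open>{B, Z}\<close> from \<open>M\<close> changes nothing.\<close>
  define f where "f = (\<lambda>(P, a, M :: nat set set set).
    let B = (THE B. B \<in> P \<and> x \<in> B); Z = \<Union>(\<Union>{e \<in> M. B \<in> e} - {B}) in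
    (THE s. a B = In_Section s, A - B - Z, Z, P - {B, Z}, restrict a (P - {B, Z}), M - {{B, Z}}))"
  have block: "(THE B. B \<in> P \<and> x \<in> B) = B" if "partition_on C P" "B \<in> P" "x \<in> B" for B C P
    using that by (intro the_equality) (auto simp: partition_on_def disjoint_def)
  have f_alone: "f (P, a, M) = (s, A - B, {}, P - {B}, restrict a (P - {B}), M)"
    if h: "partition_on C P" "B \<in> P" "x \<in> B" "a B = In_Section s" "B \<notin> \<Union>M" for B C P a M s
  proof -
    have "{e \<in> M. B \<in> e} = {}" using h(5) by blast
    then have Z: "\<Union>(\<Union>{e \<in> M. B \<in> e} - {B}) = {}" by (simp only:) simp
    have "{} \<notin> P" using h(1) by (auto dest: partition_onD3)
    moreover have "{B, {}} \<notin> M" using h(5) by blast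
    ultimately show ?thesis
      unfolding f_def prod.case Let_def block[OF h(1-3)] Z using h(4) by (simp add: insert_commute[of B])
  qed
  have f_paired: "f (P, a, M) =
      (s, A - B - Z, Z, P - {B, Z}, restrict a (P - {B, Z}), M - {{B, Z}})"
    if h: "partition_on C P" "B \<in> P" "x \<in> B" "a B = In_Section s" "{B, Z} \<in> M" "B \<noteq> Z" "disjoint M"
    for B C P a M s Z
  proof -
    have "e = {B, Z}" if "e \<in> M" "B \<in> e" for e
      using disjointD[OF h(7) that(1) h(5)] that(2) by blast
    then have "{e \<in> M. B \<in> e} = {{B, Z}}" using h(5) by blast
    then have Z: "\<Union>(\<Union>{e \<in> M. B \<in> e} - {B}) = Z" using h(6) by auto
    show ?thesis
      unfolding f_def prod.case Let_def block[OF h(1-3)] Z using h(4) by simp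
  qed
  have g: "?g z \<in> ?R \<and> f (?g z) = z" if z: "z \<in> ?D" for z
  proof -
    obtain s U Z P a M where zeq: "z = (s, U, Z, P, a, M)" by (cases z) auto
    from z have h: "s \<in> {1..l}" "U \<subseteq> A" "Z \<subseteq> A - U" "partition_on U P"
      "placement_on l {} P a" "is_section_matching l P a M"
      by (auto simp: zeq configurations_on_def)
    have ae: "a \<in> extensional P" using h(5) by (simp add: placement_on_iff)
    then have ext: "restrict a P = a" by (rule extensional_restrict)
    note MP = section_matching_Union[OF h(6)]
    define B where "B = insert x (A - U - Z)"
    have xU: "x \<notin> U" using h(2) assms by auto
    have BP: "B \<notin> P" using h(4) xU by (auto simp: B_def partition_on_def)
    have BU: "B \<inter> U = {}" "B \<noteq> {}" "x \<in> B" using xU by (auto simp: B_def)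
    show ?thesis
    proof (cases "Z = {}")
      case True
      have A: "insert x A = B \<union> U" "A - B = U" using True h(2) assms by (auto simp: B_def)
      have p: "partition_on (insert x A) (insert B P)"
        unfolding A(1) by (rule partition_on_add_block) (use BU h(4) in auto)
      have q: "placement_on l {} (insert B P) (a(B := In_Section s))"
        by (rule placement_on_add_section) (use h BP in auto)
      have m: "is_section_matching l (insert B P) (a(B := In_Section s)) M"
        by (rule section_matching_transfer[OF h(6)]) (use MP BP in auto)
      have "?g z = (insert B P, a(B := In_Section s), M)"
        using True by (simp add: zeq B_def Let_def)
      moreover have "f (insert B P, a(B := In_Section s), M) = z"
        by (subst f_alone[OF p, of B]) (use BU BP MP A ext True in \<open>auto simp: zeq\<close>)
      ultimately show ?thesis using p q m by (simp add: configurations_on_def)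
    next
      case False
      let ?a = "a(Z := In_Section s, B := In_Section s)"
      have A: "insert x A = B \<union> (Z \<union> U)" "A - B - Z = U" using h(2,3) assms by (auto simp: B_def)
      have BZ: "B \<inter> Z = {}" using h(3) assms by (auto simp: B_def)
      then have ne: "B \<noteq> Z" using BU by auto
      have ZP: "Z \<notin> P" using h(3,4) False by (auto simp: partition_on_def)
      have "partition_on (Z \<union> U) (insert Z P)"
        by (rule partition_on_add_block) (use h(3,4) False in auto)
      then have p: "partition_on (insert x A) (insert B (insert Z P))"
        unfolding A(1) by (rule partition_on_add_block) (use BU BZ in auto)
      have q: "placement_on l {} (insert B (insert Z P)) ?a"
        using h(1,5) BP ZP ne by (intro placement_on_add_section) auto
      have "is_section_matching l (insert B (insert Z P)) ?a M"
        by (rule section_matching_transfer[OF h(6)]) (use MP BP ZP in auto)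
      then have m: "is_section_matching l (insert B (insert Z P)) ?a (insert {B, Z} M)"
        by (rule section_matching_insert[where s = s]) (use h(1) ne MP BP ZP in auto)
      have dj: "disjoint (insert {B, Z} M)" using m by (simp add: is_section_matching_def)
      have geq: "?g z = (insert B (insert Z P), ?a, insert {B, Z} M)"
        using False by (simp add: zeq B_def Let_def)
      have "insert B (insert Z P) - {B, Z} = P" using BP ZP by auto
      moreover have "insert {B, Z} M - {{B, Z}} = M" using BP MP by auto
      moreover have "restrict ?a P = a" using BP ZP ext by simp
      ultimately have "f (insert B (insert Z P), ?a, insert {B, Z} M) = z"
        by (subst f_paired[OF p _ BU(3) _ _ ne dj, where s = s]) (simp_all add: A(2) zeq)
      then show ?thesis using p q m geq by (simp add: configurations_on_def)
    qed
  qed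
  have f: "f c \<in> ?D \<and> ?g (f c) = c" if c: "c \<in> ?R" for c
  proof -
    obtain P a M where ceq: "c = (P, a, M)" by (cases c) auto
    from c have h: "partition_on (insert x A) P" "placement_on l {} P a" "is_section_matching l P a M"
      by (auto simp: ceq configurations_on_def)
    have ae: "a \<in> extensional P" using h(2) by (simp add: placement_on_iff)
    have ne: "{} \<notin> P" using h(1) by (auto dest: partition_onD3)
    note MP = section_matching_Union[OF h(3)]
    have dj: "disjoint M" using h(3) by (simp add: is_section_matching_def)
    obtain B where B: "B \<in> P" "x \<in> B" using h(1) by (auto simp: partition_on_def)
    obtain s where s: "s \<in> {1..l}" "a B = In_Section s"
      using h(2) B(1) by (auto simp: placement_on_iff)
    have BA: "B \<subseteq> insert x A" using B h(1) by (auto simp: partition_on_def)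
    have p: "partition_on (insert x A - B) (P - {B})"
      using h(1) B(1) by (rule partition_on_remove_block)
    have AB: "insert x A - B = A - B" using B by auto
    show ?thesis
    proof (cases "B \<in> \<Union>M")
      case False
      have feq: "f c = (s, A - B, {}, P - {B}, restrict a (P - {B}), M)"
        unfolding ceq by (rule f_alone) (fact h(1) B s(2) False)+
      have m: "is_section_matching l (P - {B}) (restrict a (P - {B})) M"
        by (rule section_matching_transfer[OF h(3)]) (use MP False in auto)
      have q: "placement_on l {} (P - {B}) (restrict a (P - {B}))"
        using h(2) by (rule placement_on_restrict) auto
      have "insert x (A - (A - B)) = B" using B BA by auto
      moreover have "(restrict a (P - {B}))(B := In_Section s) = a"
        using fun_upd_restrict_same[of a B "P - {B}"] ae B s by (simp add: insert_absorb)
      ultimately show ?thesis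
        unfolding feq using p q m s B by (simp add: Let_def ceq configurations_on_def insert_absorb AB)
    next
      case True
      then obtain e where e: "e \<in> M" "B \<in> e" by auto
      then obtain t C D where "C \<in> P" "D \<in> P" "e = {C, D}" "C \<noteq> D"
          "a C = In_Section t" "a D = In_Section t"
        using h(3) unfolding is_section_matching_def by meson
      then obtain Z where Z: "Z \<in> P" "e = {B, Z}" "B \<noteq> Z" "a Z = a B"
        using e(2) by (metis empty_iff insert_commute insert_iff)
      have M: "{B, Z} \<in> M" using e Z by simp
      have feq: "f c = (s, A - B - Z, Z, P - {B, Z}, restrict a (P - {B, Z}), M - {{B, Z}})"
        unfolding ceq by (rule f_paired) (fact h(1) B s(2) M Z(3) dj)+
      have BZ: "B \<inter> Z = {}" using disjointD[OF partition_onD2[OF h(1)] B(1) Z(1,3)] .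
      have "Z \<subseteq> insert x A" using partition_onD1[OF h(1)] Z(1) by blast
      then have ZA: "Z \<subseteq> A" using BZ B(2) by blast
      have "Z \<noteq> {}" using Z(1) ne by blast
      have "partition_on (insert x A - B - Z) (P - {B} - {Z})"
        using p by (rule partition_on_remove_block) (use Z in auto)
      moreover have "P - {B} - {Z} = P - {B, Z}" by blast
      ultimately have p': "partition_on (A - B - Z) (P - {B, Z})" by (simp add: AB)
      have q: "placement_on l {} (P - {B, Z}) (restrict a (P - {B, Z}))"
        using h(2) by (rule placement_on_restrict) auto
      have "d \<inter> {B, Z} = {}" if "d \<in> M - {{B, Z}}" for d
        using disjointD[OF dj _ M, of d] that by blast
      then have MBZ: "\<Union>(M - {{B, Z}}) \<subseteq> P - {B, Z}" using MP by blast
      have m: "is_section_matching l (P - {B, Z}) (restrict a (P - {B, Z})) (M - {{B, Z}})"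
        by (rule section_matching_transfer[OF h(3) _ MBZ]) auto
      have "insert x (A - (A - B - Z) - Z) = B" using B(2) BA BZ ZA assms by blast
      moreover have "(restrict a (P - {B, Z}))(Z := In_Section s, B := In_Section s) = a"
        using ae s(2) Z(4) by (simp add: fun_eq_iff extensional_def) metis
      moreover have "insert B (insert Z (P - {B, Z})) = P" using B(1) Z(1) by blast
      moreover have "Z \<subseteq> A - (A - B - Z)" "A - B - Z \<subseteq> A" using ZA by blast+
      ultimately show ?thesis
        unfolding feq using p' q m s(1) M \<open>Z \<noteq> {}\<close>
        by (simp add: Let_def ceq configurations_on_def insert_absorb del: restrict_upd)
    qed
  qed
  show ?thesis
    by (rule bij_betw_byWitness[where f' = f]) (use f g in blast)+
qed

section \<open>Counting\<close>

lemma card_configurations_on_no_singletons: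
  assumes "finite A"
  shows "finite (configurations_on l A {}) \<and>
    real (card (configurations_on l A {})) = whitney_poly 2 (real l) (card A)"
  using assms
proof (induction A rule: finite_psubset_induct)
  case (psubset A)
  show ?case
  proof (cases "A = {}")
    case True
    have "configurations_on l {} {} = {({}, \<lambda>_. undefined, {})}"
      by (auto simp: configurations_on_def placement_on_iff is_section_matching_def
          partition_on_empty)
    then show ?thesis by (simp add: True whitney_poly_def whitney2_def)
  next
    case False
    then obtain x A' where A: "A = insert x A'" "x \<notin> A'" by (meson equals0I mk_disjoint_insert)
    have fin: "finite A'" using psubset.hyps A by simp
    have IH: "finite (configurations_on l U {})"
        "real (card (configurations_on l U {})) = whitney_poly 2 (real l) (card U)"
      if "U \<subseteq> A'" for U
      using psubset.IH[of U] that A by auto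
    let ?E = "SIGMA U:Pow A'. Pow (A' - U) \<times> configurations_on l U {}"
    have finE: "finite ?E"
      using fin IH by (intro finite_SigmaI finite_cartesian_product) (auto intro: finite_subset)
    note bij = bij_betw_remove_component[OF A(2), of l]
    have "finite (configurations_on l A {})"
      using bij_betw_finite[OF bij] finE by (simp add: A(1))
    moreover have "real (card (configurations_on l A {})) = whitney_poly 2 (real l) (card A)"
    proof -
      have "real (card (configurations_on l A {})) = real l * real (card ?E)"
        using bij_betw_same_card[OF bij, symmetric] by (simp add: A(1) card_cartesian_product)
      also have "card ?E = (\<Sum>U\<in>Pow A'. 2 ^ (card A' - card U) * card (configurations_on l U {}))"
        using fin IH
        by (subst card_SigmaI) (auto simp: card_cartesian_product card_Pow card_Diff_subset
            finite_subset intro!: sum.cong)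
      also have "real l * real \<dots> =
          (\<Sum>U\<in>Pow A'. real l * real 2 ^ (card A' - card U) * whitney_poly 2 (real l) (card U))"
        using IH by (simp add: sum_distrib_left mult_ac)
      also have "\<dots> = whitney_poly 2 (real l) (Suc (card A'))"
        using sum_Pow_card[OF fin, of "\<lambda>u. real l * real 2 ^ (card A' - u) * whitney_poly 2 (real l) u"]
        by (simp add: whitney_poly_Suc)
      finally show ?thesis using fin A by simp
    qed
    ultimately show ?thesis ..
  qed
qed

lemma card_configurations_on:
  assumes "finite T" "finite A"
  shows "finite (configurations_on l A T) \<and>
    real (card (configurations_on l A T)) =
      (\<Sum>k=0..card A. nested_sum k (\<lambda>i. whitney2 2 0 i k * real l ^ k) (card T) (card A))"
  using assms
proof (induction T arbitrary: A rule: finite_induct)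
  case empty
  then show ?case
    using card_configurations_on_no_singletons[of A l] by (simp add: whitney_poly_def)
next
  case (insert S T)
  let ?w = "\<lambda>n. \<Sum>k=0..n. nested_sum k (\<lambda>i. whitney2 2 0 i k * real l ^ k) (card T) n"
  have IH: "finite (configurations_on l U T)" "real (card (configurations_on l U T)) = ?w (card U)"
    if "U \<subseteq> A" for U
    using insert.IH[of U] insert.prems that by (auto dest: finite_subset)
  note bij = bij_betw_remove_singleton[OF insert.hyps(2), of A l]
  have "finite (configurations_on l A (insert S T))"
    unfolding bij_betw_finite[OF bij, symmetric]
    by (intro finite_SigmaI) (use insert.prems IH in auto)
  moreover have "real (card (configurations_on l A (insert S T))) =
      (\<Sum>U\<in>Pow A. ?w (card U))"
    using bij_betw_same_card[OF bij, symmetric] insert.prems IH by (simp add: card_SigmaI)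
  moreover have "\<dots> = (\<Sum>k=0..card A.
      nested_sum k (\<lambda>i. whitney2 2 0 i k * real l ^ k) (Suc (card T)) (card A))"
    by (subst sum_nested_sum_Suc) (rule sum_Pow_card[OF insert.prems])
  ultimately show ?case using insert.hyps by simp
qed

theorem theorem4p8:
  fixes n r l :: nat
  assumes "l \<ge> 1"
  shows "real (B_tilde r l n) =
    (\<Sum>k=0..n. nested_sum k (\<lambda>i. whitney2 2 0 i k * real l ^ k) r n)"
proof -
  have "configurations r l n = configurations_on l {r + 1..n + r} (singleton_blocks r)"
    by (simp add: configurations_def configurations_on_def is_placement_def placement_on_def)
  moreover have "card (singleton_blocks r) = r" "finite (singleton_blocks r)"
    by (simp_all add: singleton_blocks_def card_image)
  ultimately show ?thesis
    using card_configurations_on[of "singleton_blocks r" "{r + 1..n + r}" l]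
    by (simp add: B_tilde_def)
qed

end
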